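(* Let $\lambda>0$ and let $X_1,X_2,\dots$ be i.i.d. exponential random variables with mean $\lambda^{-1}$. Let $X_{(1)}$ and $X_{(n)}$ denote the minimum and maximum of $X_1,\dots,X_n$. Then, as $n\to\infty$, $\lambda(X_{(n)}-X_{(1)})-\log(n)$ converges in distribution to a Gumbel distribution.
   Context: The Gumbel distribution is the (standard) distribution with cumulative distribution function $x\mapsto\exp(-e^{-x})$, $x\in\mathbb{R}$. *)

theory Defs
  imports "HOL-Probability.Probability" "HOL-Real_Asymp.Real_Asymp"
begin

text \<open>
  The law with cumulative distribution function \<open>exp (- exp (- x))\<close>, as the
  Lebesgue--Stieltjes measure of that function. The lemmas below confirm that it is a probability
  measure with this distribution function (\<^const>\<open>interval_measure\<close> says nothing about functions
  that are not monotone and right-continuous).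
\<close>

definition gumbel_distribution :: "real measure" where
  "gumbel_distribution = interval_measure (\<lambda>x. exp (- exp (- x)))"

lemma
  real_distribution_gumbel: "real_distribution gumbel_distribution" and
  cdf_gumbel: "cdf gumbel_distribution = (\<lambda>x. exp (- exp (- x)))"
proof -
  let ?F = "\<lambda>x::real. exp (- exp (- x))"
  have mono: "?F x \<le> ?F y" if "x \<le> y" for x y
    using that by simp
  have cont: "continuous (at_right x) ?F" for x
    by (intro continuous_intros)
  have bot: "(?F \<longlongrightarrow> 0) at_bot" and top: "(?F \<longlongrightarrow> 1) at_top"
    by real_asymp+
  show "real_distribution gumbel_distribution"
    unfolding gumbel_distribution_def
    by (rule real_distribution_interval_measure[OF mono cont bot top])
  show "cdf gumbel_distribution = ?F"
    unfolding gumbel_distribution_def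
    by (rule cdf_interval_measure[OF mono cont bot])
qed

end

theory Submission
  imports Defs
begin

text \<open>
  Write \<open>\<lambda>\<close> for the rate, \<open>L = \<lambda> X\<^sub>(\<^sub>n\<^sub>)\<close> for the scaled maximum and \<open>S = \<lambda> X\<^sub>(\<^sub>1\<^sub>)\<close> for the scaled minimum.
  By independence, \<open>L - ln n \<le> y\<close> has probability \<open>(1 - exp (-y) / n)\<^sup>n\<close> as soon as \<open>y + ln n \<ge> 0\<close>,
  which tends to \<open>exp (- exp (-y))\<close>: the maximum alone already has the Gumbel limit. The minimum does
  not disturb it, because \<open>S\<close> is exponential with rate \<open>n\<close> and hence vanishes in probability.

  Quantitatively, \<open>L - S - ln n \<le> x\<close> follows almost surely from \<open>L - ln n \<le> x\<close>, as \<open>S > 0\<close>;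
  conversely it forces \<open>L - ln n \<le> x + \<epsilon>\<close> or \<open>S > \<epsilon>\<close>. Hence, for large \<open>n\<close>, the distribution function of
  the centred range lies between \<open>(1 - exp (-x) / n)\<^sup>n\<close> and \<open>(1 - exp (-(x + \<epsilon>)) / n)\<^sup>n + exp (- \<epsilon> n)\<close>
  (lemmas \<open>exponential_range_cdf_lower\<close> and \<open>exponential_range_cdf_upper\<close>).
  With \<open>\<epsilon> = 1 / sqrt n\<close> both bounds converge to \<open>exp (- exp (-x))\<close>, at every real \<open>x\<close>.
\<close>

text \<open>The maximum is at most \<open>a\<close> exactly when every variable is, so independence turns the probability
  into a product.\<close>

lemma (in prob_space) prob_Max_le_indep_vars:
  fixes X :: "'i \<Rightarrow> 'a \<Rightarrow> real"
  assumes fin: "finite I" and ne: "I \<noteq> {}" and ind: "indep_vars (\<lambda>_. borel) X I"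
  shows "\<P>(\<omega> in M. (MAX i\<in>I. X i \<omega>) \<le> a) = (\<Prod>i\<in>I. \<P>(\<omega> in M. X i \<omega> \<le> a))"
proof -
  have "{\<omega>\<in>space M. (MAX i\<in>I. X i \<omega>) \<le> a} = (\<Inter>i\<in>I. X i -` {..a} \<inter> space M)"
    using fin ne by auto
  moreover have "X i -` {..a} \<inter> space M = {\<omega>\<in>space M. X i \<omega> \<le> a}" for i
    by auto
  ultimately show ?thesis
    using indep_varsD[OF ind ne fin subset_refl, of "\<lambda>_. {..a}"] by simp
qed

text \<open>
  Centring by \<open>ln n\<close> makes each of the \<open>n\<close> equal tail probabilities \<open>exp (-y) / n\<close>. For
  \<open>y + ln n < 0\<close> the threshold is negative and the left-hand side is \<open>0\<close> instead, which is why the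
  range of \<open>y\<close> is restricted; every fixed \<open>y\<close> satisfies the restriction for large \<open>n\<close>.
\<close>

lemma (in prob_space) exponential_Max_centred_cdf:
  assumes n: "n \<ge> 1" and rate: "rate > 0"
    and ind: "indep_vars (\<lambda>_. borel) X {1..n}"
    and X: "\<And>i. i \<in> {1..n} \<Longrightarrow> distributed M lborel (X i) (exponential_density rate)"
    and y: "y + ln (real n) \<ge> 0"
  shows "\<P>(\<omega> in M. rate * (MAX i\<in>{1..n}. X i \<omega>) - ln (real n) \<le> y) = (1 - exp (- y) / real n) ^ n"
proof -
  let ?a = "(y + ln (real n)) / rate"
  have "\<P>(\<omega> in M. X i \<omega> \<le> ?a) = 1 - exp (- y) / real n" if "i \<in> {1..n}" for i
  proof -
    have "\<P>(\<omega> in M. X i \<omega> \<le> ?a) = 1 - exp (- ?a * rate)"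
      using y rate by (intro exponential_distributedD_le[OF X[OF that]]) auto
    also have "- ?a * rate = - y - ln (real n)"
      using rate by (simp add: field_simps)
    finally show ?thesis
      using n by (simp add: exp_diff)
  qed
  moreover have "rate * m - ln (real n) \<le> y \<longleftrightarrow> m \<le> ?a" for m
    using rate by (auto simp: field_simps)
  ultimately show ?thesis
    using n prob_Max_le_indep_vars[OF _ _ ind, of ?a] by simp
qed

text \<open>The minimum of \<open>n\<close> independent exponential variables is again exponential, the rates adding up to
  \<open>n * rate\<close>. This tail is both the error term in the upper bound below and, at \<open>e = 0\<close>, the almost
  sure positivity used in the lower bound.\<close>

lemma (in prob_space) exponential_Min_gt:
  assumes n: "n \<ge> 1" and rate: "rate > 0"
    and ind: "indep_vars (\<lambda>_. borel) X {1..n}"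
    and X: "\<And>i. i \<in> {1..n} \<Longrightarrow> distributed M lborel (X i) (exponential_density rate)"
    and e: "e \<ge> 0"
  shows "\<P>(\<omega> in M. rate * (MIN i\<in>{1..n}. X i \<omega>) > e) = exp (- e * real n)"
proof -
  have "distributed M lborel (\<lambda>\<omega>. MIN i\<in>{1..n}. X i \<omega>) (exponential_density (\<Sum>i\<in>{1..n}. rate))"
    using n rate X ind by (intro exponential_distributed_Min) auto
  then have "\<P>(\<omega> in M. e / rate < (MIN i\<in>{1..n}. X i \<omega>)) = exp (- (e / rate) * (\<Sum>i\<in>{1..n}. rate))"
    using n rate e by (intro exponential_distributedD_gt) auto
  moreover have "rate * m > e \<longleftrightarrow> e / rate < m" for m
    using rate by (auto simp: field_simps)
  ultimately show ?thesis
    using rate by simp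
qed

text \<open>Subtracting the almost surely positive minimum only decreases the maximum, so the range has the
  larger distribution function.\<close>

lemma (in prob_space) exponential_range_cdf_lower:
  assumes n: "n \<ge> 1" and rate: "rate > 0"
    and ind: "indep_vars (\<lambda>_. borel) X {1..n}"
    and X: "\<And>i. i \<in> {1..n} \<Longrightarrow> distributed M lborel (X i) (exponential_density rate)"
    and x: "x + ln (real n) \<ge> 0"
  shows "(1 - exp (- x) / real n) ^ n \<le>
    \<P>(\<omega> in M. rate * ((MAX i\<in>{1..n}. X i \<omega>) - (MIN i\<in>{1..n}. X i \<omega>)) - ln (real n) \<le> x)"
proof -
  have rv [measurable]: "X i \<in> borel_measurable M" if "i \<in> {1..n}" for i
    using ind that by (auto simp: indep_vars_def)
  have [measurable]: "(\<lambda>\<omega>. MAX i\<in>{1..n}. X i \<omega>) \<in> borel_measurable M"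
      "(\<lambda>\<omega>. MIN i\<in>{1..n}. X i \<omega>) \<in> borel_measurable M"
    using rv by measurable
  have "AE \<omega> in M. rate * (MIN i\<in>{1..n}. X i \<omega>) > 0"
    using exponential_Min_gt[OF n rate ind X, of 0]
    by (intro iffD1[OF prob_Collect_eq_1]) auto
  then have "AE \<omega> in M. rate * (MAX i\<in>{1..n}. X i \<omega>) - ln (real n) \<le> x \<longrightarrow>
      rate * ((MAX i\<in>{1..n}. X i \<omega>) - (MIN i\<in>{1..n}. X i \<omega>)) - ln (real n) \<le> x"
    by eventually_elim (auto simp: algebra_simps)
  then have "\<P>(\<omega> in M. rate * (MAX i\<in>{1..n}. X i \<omega>) - ln (real n) \<le> x) \<le>
      \<P>(\<omega> in M. rate * ((MAX i\<in>{1..n}. X i \<omega>) - (MIN i\<in>{1..n}. X i \<omega>)) - ln (real n) \<le> x)"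
    by (intro finite_measure_mono_AE) auto
  then show ?thesis
    using exponential_Max_centred_cdf[OF n rate ind X x] by simp
qed

text \<open>If the scaled minimum is at most \<open>e\<close>, then the scaled maximum exceeds the scaled range by at most
  \<open>e\<close>; a union bound charges the remaining event to the tail of the minimum.\<close>

lemma (in prob_space) exponential_range_cdf_upper:
  assumes n: "n \<ge> 1" and rate: "rate > 0"
    and ind: "indep_vars (\<lambda>_. borel) X {1..n}"
    and X: "\<And>i. i \<in> {1..n} \<Longrightarrow> distributed M lborel (X i) (exponential_density rate)"
    and e: "e \<ge> 0" and x: "x + e + ln (real n) \<ge> 0"
  shows "\<P>(\<omega> in M. rate * ((MAX i\<in>{1..n}. X i \<omega>) - (MIN i\<in>{1..n}. X i \<omega>)) - ln (real n) \<le> x)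
    \<le> (1 - exp (- (x + e)) / real n) ^ n + exp (- e * real n)"
proof -
  have rv [measurable]: "X i \<in> borel_measurable M" if "i \<in> {1..n}" for i
    using ind that by (auto simp: indep_vars_def)
  have [measurable]: "(\<lambda>\<omega>. MAX i\<in>{1..n}. X i \<omega>) \<in> borel_measurable M"
      "(\<lambda>\<omega>. MIN i\<in>{1..n}. X i \<omega>) \<in> borel_measurable M"
    using rv by measurable
  let ?A = "{\<omega>\<in>space M. rate * (MAX i\<in>{1..n}. X i \<omega>) - ln (real n) \<le> x + e}"
  let ?B = "{\<omega>\<in>space M. rate * (MIN i\<in>{1..n}. X i \<omega>) > e}"
  have "\<P>(\<omega> in M. rate * ((MAX i\<in>{1..n}. X i \<omega>) - (MIN i\<in>{1..n}. X i \<omega>)) - ln (real n) \<le> x)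
      \<le> prob (?A \<union> ?B)"
    by (intro finite_measure_mono) (auto simp: algebra_simps)
  also have "\<dots> \<le> prob ?A + prob ?B"
    by (intro measure_Un_le) auto
  finally show ?thesis
    using exponential_Max_centred_cdf[OF n rate ind X x] exponential_Min_gt[OF n rate ind X e]
    by simp
qed

theorem theorem6:
  fixes M :: "'a measure"
    and X :: "nat \<Rightarrow> 'a \<Rightarrow> real"
    and rate :: real
  assumes "prob_space M"
    and "rate > 0"
    and "prob_space.indep_vars M (\<lambda>_. borel) X {1..}"
    and "\<And>i. i \<ge> 1 \<Longrightarrow> distributed M lborel (X i) (exponential_density rate)"
  shows "weak_conv_m
    (\<lambda>n. distr M borel
      (\<lambda>\<omega>. rate * ((MAX i\<in>{1..n}. X i \<omega>) - (MIN i\<in>{1..n}. X i \<omega>)) - ln (real n)))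
    gumbel_distribution"
proof -
  interpret prob_space M by fact
  define R where
    "R n \<omega> = rate * ((MAX i\<in>{1..n}. X i \<omega>) - (MIN i\<in>{1..n}. X i \<omega>)) - ln (real n)" for n \<omega>
  have rv: "X i \<in> borel_measurable M" if "i \<ge> 1" for i
    using assms(3) that by (auto simp: indep_vars_def)
  have ind: "indep_vars (\<lambda>_. borel) X {1..n}" for n
    using assms(3) by (rule indep_vars_subset) auto
  have X: "distributed M lborel (X i) (exponential_density rate)" if "i \<in> {1..n}" for i n :: nat
    using assms(4) that by simp
  have cdf_R: "cdf (distr M borel (R n)) x = \<P>(\<omega> in M. R n \<omega> \<le> x)" for n x
  proof -
    have "R n \<in> borel_measurable M"
      unfolding R_def by (intro borel_measurable_diff borel_measurable_times borel_measurable_const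
          borel_measurable_Max borel_measurable_Min) (auto intro: rv)
    moreover have "R n -` {..x} \<inter> space M = {\<omega>\<in>space M. R n \<omega> \<le> x}"
      by auto
    ultimately show ?thesis
      by (simp add: cdf_def measure_distr)
  qed
  have "(\<lambda>n. cdf (distr M borel (R n)) x) \<longlonglongrightarrow> exp (- exp (- x))" for x
  proof (rule tendsto_sandwich)
    have nonneg: "\<forall>\<^sub>F n in sequentially. x + ln (real n) \<ge> 0"
      by real_asymp
    show "\<forall>\<^sub>F n in sequentially. (1 - exp (- x) / real n) ^ n \<le> cdf (distr M borel (R n)) x"
      using nonneg eventually_ge_at_top[of 1]
    proof eventually_elim
      case (elim n)
      then show ?case
        unfolding cdf_R unfolding R_def
        by (intro exponential_range_cdf_lower[OF _ assms(2) ind X]) auto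
    qed
    \<comment> \<open>The tolerance \<open>e = 1 / sqrt n\<close> tends to \<open>0\<close>, yet slowly enough that \<open>e * n\<close> still diverges.\<close>
    show "\<forall>\<^sub>F n in sequentially. cdf (distr M borel (R n)) x \<le>
        (1 - exp (- (x + 1 / sqrt (real n))) / real n) ^ n + exp (- (1 / sqrt (real n)) * real n)"
      using nonneg eventually_ge_at_top[of 1]
    proof eventually_elim
      case (elim n)
      have "0 \<le> x + 1 / sqrt (real n) + ln (real n)"
        using elim(1) add_increasing2[of "1 / sqrt (real n)" 0 "x + ln (real n)"]
        by (simp add: algebra_simps)
      with elim show ?case
        unfolding cdf_R unfolding R_def
        by (intro exponential_range_cdf_upper[OF _ assms(2) ind X]) auto
    qed
    show "(\<lambda>n. (1 - exp (- x) / real n) ^ n) \<longlonglongrightarrow> exp (- exp (- x))"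
      by real_asymp
    show "(\<lambda>n. (1 - exp (- (x + 1 / sqrt (real n))) / real n) ^ n
        + exp (- (1 / sqrt (real n)) * real n)) \<longlonglongrightarrow> exp (- exp (- x))"
      by real_asymp
  qed
  then show ?thesis
    unfolding weak_conv_m_def weak_conv_def cdf_gumbel R_def by simp
qed

end
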